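(* Let $1\leq p,q<\infty$ and $\alpha\in\left(\frac1q,1\right]$. Then the following Gagliardo--Nirenberg type inequality holds, with a constant $C>0$ independent of $u$: $$\|u\|_{L^{\gamma}(a, b)}\leq C\,\|\mathfrak{D}^{\alpha}_{a+} u\|_{L_{\frac{1}{x}}^{q}(a, b)}^{s}\, \|u\|_{L^{p}(a, b)}^{1-s},$$ with $$\frac{\gamma s}{q}+\frac{\gamma(1-s)}{p}=1,$$ where $s\in[0,1]$ and $\mathfrak{D}^{\alpha}_{a+}$ is the left Hadamard fractional derivative of order $\alpha$.
   Context: Here $0<a<b<\infty$ and $\Gamma$ is the Euler gamma function. For $\alpha>0$ the left Hadamard fractional integral is $\mathfrak{I}_{a+}^{\alpha}f(t)=\frac{1}{\Gamma(\alpha)}\int_{a}^{t}\left(\log\frac{t}{s}\right)^{\alpha-1}f(s)\,\frac{ds}{s}$, $t\in(a,b]$. For $0<\alpha<1$ the left Hadamard fractional derivative is $\mathfrak{D}_{a+}^{\alpha}f(t)=\frac{1}{\Gamma(1-\alpha)}\int_{a}^{t}\left(\log\frac{t}{s}\right)^{-\alpha}f'(s)\,\frac{ds}{s}$, $t\in(a,b]$, that is, $\mathfrak{D}_{a+}^{\alpha}f=\mathfrak{I}_{a+}^{1-\alpha}f'$; for $\alpha=1$ this is read with $\mathfrak{I}_{a+}^{0}$ the identity. For $q\ge1$, $\|v\|_{L^{q}_{\frac{1}{x}}(a,b)}=\left(\int_{a}^{b}|v(x)|^{q}\frac{dx}{x}\right)^{1/q}$, and $\|u\|_{L^r(a,b)}=\left(\int_a^b|u(x)|^r\,dx\right)^{1/r}$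 for $r>0$. The functions $u$ considered are those on $(a,b)$ for which $\mathfrak{D}^{\alpha}_{a+}u$ and the norms above are defined.
   Formalization: The condition u(a+)=0 is added: as stated the inequality fails for u=1 and every s in (0,1], since the derivative of a constant is 0; the condition is also imposed at s=0, where γ=p and the inequality is trivial. *)

theory Defs
  imports "HOL-Analysis.Analysis"
begin

text \<open>The value at \<open>\<alpha> = 0\<close> is the identity; the integral formula is meant for \<open>\<alpha> > 0\<close>.\<close>
definition hadamard_integral :: "real \<Rightarrow> real \<Rightarrow> (real \<Rightarrow> real) \<Rightarrow> real \<Rightarrow> real" where
  "hadamard_integral a \<alpha> f t =
     (if \<alpha> = 0 then f t
      else 1 / Gamma \<alpha> * (LINT s:{a<..<t}|lborel. ln (t / s) powr (\<alpha> - 1) * f s / s))"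

text \<open>The Bochner integral is 0 on non-integrable functions, so existence of the
  integral (as a Lebesgue integral) is a separate predicate.\<close>
definition hadamard_integral_exists :: "real \<Rightarrow> real \<Rightarrow> (real \<Rightarrow> real) \<Rightarrow> real \<Rightarrow> bool" where
  "hadamard_integral_exists a \<alpha> f t \<longleftrightarrow>
     \<alpha> = 0 \<or> set_integrable lborel {a<..<t} (\<lambda>s. ln (t / s) powr (\<alpha> - 1) * f s / s)"

text \<open>The ordinary derivative \<open>f'\<close> is used, not \<open>s f'(s)\<close>.  For \<open>0 < \<alpha> < 1\<close> this unfolds to
  \<open>1 / Gamma (1 - \<alpha>)\<close> times the integral of \<open>ln (t / s) powr (- \<alpha>) * f'(s) / s\<close> over \<open>(a, t)\<close>.\<close>
definition hadamard_deriv :: "real \<Rightarrow> real \<Rightarrow> (real \<Rightarrow> real) \<Rightarrow> real \<Rightarrow> real" where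
  "hadamard_deriv a \<alpha> f = hadamard_integral a (1 - \<alpha>) (deriv f)"

text \<open>Local absolute continuity on \<open>(a, b)\<close>, in the form of the fundamental theorem of
  calculus.  It covers in particular every function that is differentiable everywhere on
  \<open>(a, b)\<close> with locally Lebesgue integrable derivative.  On the null set where \<open>f\<close> is not
  differentiable, \<open>deriv f\<close> is an unspecified constant, which does not affect any integral.\<close>
definition locally_abs_cont :: "real \<Rightarrow> real \<Rightarrow> (real \<Rightarrow> real) \<Rightarrow> bool" where
  "locally_abs_cont a b f \<longleftrightarrow>
     (AE t in lborel. a < t \<and> t < b \<longrightarrow> f differentiable (at t)) \<and>
     (\<forall>c d. a < c \<and> c \<le> d \<and> d < b \<longrightarrow>
        set_integrable lborel {c..d} (deriv f) \<and>
        (LINT s:{c..d}|lborel. deriv f s) = f d - f c)"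

definition hadamard_deriv_exists :: "real \<Rightarrow> real \<Rightarrow> real \<Rightarrow> (real \<Rightarrow> real) \<Rightarrow> bool" where
  "hadamard_deriv_exists a b \<alpha> f \<longleftrightarrow>
     locally_abs_cont a b f \<and>
     (AE t in lborel. a < t \<and> t < b \<longrightarrow> hadamard_integral_exists a (1 - \<alpha>) (deriv f) t)"

text \<open>Lebesgue spaces on \<open>(a, b)\<close> with respect to the measure \<open>w(x) dx\<close>:
  \<open>w = (\<lambda>x. 1 / x)\<close> gives the logarithmic measure and \<open>w = (\<lambda>x. 1)\<close> plain Lebesgue measure.\<close>
definition in_Lw :: "(real \<Rightarrow> real) \<Rightarrow> real \<Rightarrow> real \<Rightarrow> real \<Rightarrow> (real \<Rightarrow> real) \<Rightarrow> bool" where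
  "in_Lw w r a b v \<longleftrightarrow>
     set_borel_measurable lborel {a<..<b} v \<and>
     set_integrable lborel {a<..<b} (\<lambda>x. \<bar>v x\<bar> powr r * w x)"

definition Lw_norm :: "(real \<Rightarrow> real) \<Rightarrow> real \<Rightarrow> real \<Rightarrow> real \<Rightarrow> (real \<Rightarrow> real) \<Rightarrow> real" where
  "Lw_norm w r a b v = (LINT x:{a<..<b}|lborel. \<bar>v x\<bar> powr r * w x) powr (1 / r)"

abbreviation in_L :: "real \<Rightarrow> real \<Rightarrow> real \<Rightarrow> (real \<Rightarrow> real) \<Rightarrow> bool" where
  "in_L \<equiv> in_Lw (\<lambda>x. 1)"

abbreviation L_norm :: "real \<Rightarrow> real \<Rightarrow> real \<Rightarrow> (real \<Rightarrow> real) \<Rightarrow> real" where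
  "L_norm \<equiv> Lw_norm (\<lambda>x. 1)"

abbreviation in_Llog :: "real \<Rightarrow> real \<Rightarrow> real \<Rightarrow> (real \<Rightarrow> real) \<Rightarrow> bool" where
  "in_Llog \<equiv> in_Lw (\<lambda>x. 1 / x)"

abbreviation Llog_norm :: "real \<Rightarrow> real \<Rightarrow> real \<Rightarrow> (real \<Rightarrow> real) \<Rightarrow> real" where
  "Llog_norm \<equiv> Lw_norm (\<lambda>x. 1 / x)"

end

theory Submission
  imports Defs
begin

text \<open>
  The derivative uses \<open>f'\<close> and the integral the measure \<open>ds / s\<close>, so composing the two gives
  \<open>I\<^sup>\<alpha> (D\<^sup>\<alpha> u) = v\<close> with \<open>v t = \<integral>\<^sub>a\<^sup>t u'(s) / s ds\<close> rather than \<open>u\<close> itself: by Fubini this reduces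
  to a Beta integral in the variable \<open>ln s\<close>.  Since \<open>\<alpha> > 1 / q\<close>, the kernel of \<open>I\<^sup>\<alpha>\<close> lies in
  the dual Lebesgue space, hence \<open>sup \<bar>v\<bar> \<le> K \<parallel>D\<^sup>\<alpha> u\<parallel>\<close>.  Because \<open>u(a+) = 0\<close>, one recovers
  \<open>u t = \<integral>\<^sub>a\<^sup>t s dv(s)\<close>, and the second mean value theorem turns the bound on \<open>v\<close> into one on
  \<open>sup \<bar>u\<bar>\<close>.  Interpolating between \<open>L\<^sup>\<infinity>\<close> and \<open>L\<^sup>p\<close> on the bounded interval finishes the proof.
\<close>

section \<open>Beta integrals in the variable \<open>ln s\<close> and the semigroup law\<close>

text \<open>This is the inner integral when Fubini is applied to a composition of two Hadamard
  integrals. With \<open>q = 1\<close> it also integrates the power of the kernel that occurs in the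
  Hoelder estimate.\<close>

lemma log_beta_kernel:
  fixes r t p q :: real
  assumes "0 < r" "r < t" "0 < p" "0 < q"
  shows "set_integrable lborel {r<..<t} (\<lambda>s. ln (t / s) powr (p - 1) * ln (s / r) powr (q - 1) / s)"
      (is "set_integrable _ _ ?k")
    and "(LINT s:{r<..<t}|lborel. ln (t / s) powr (p - 1) * ln (s / r) powr (q - 1) / s)
           = ln (t / r) powr (p + q - 1) * Beta q p"
proof -
  \<comment> \<open>The substitution \<open>s = r exp (x L)\<close> maps \<open>[0, 1]\<close> onto \<open>[r, t]\<close> and \<open>ds / s\<close> to \<open>L dx\<close>.\<close>
  define L where "L = ln (t / r)"
  define g where "g x = r * exp (x * L)" for x
  have L: "0 < L" using assms by (simp add: L_def)
  have g0: "g 0 = r" by (simp add: g_def)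
  have g1: "g 1 = t" using assms by (simp add: g_def L_def)
  have [measurable]: "?k \<in> borel_measurable borel" by measurable
  have B: "0 < Beta q p" using assms by (simp add: Beta_def Gamma_real_pos)
  have eq: "?k (g x) * (L * g x) = L powr (p + q - 1) * (x powr (q - 1) * (1 - x) powr (p - 1))"
    if "x \<in> {0..1}" for x
  proof -
    have 1: "ln (g x / r) = L * x" using assms by (simp add: g_def)
    have "ln (t / g x) = ln (t / r) - ln (g x / r)"
      using assms by (simp add: g_def ln_div ln_mult)
    then have 2: "ln (t / g x) = L * (1 - x)" unfolding 1 L_def by (simp add: algebra_simps)
    have "L powr (p + q - 1) = L powr (p - 1) * L powr (q - 1) * L"
      using L by (simp add: powr_diff powr_add field_simps)
    moreover have "0 < g x" using assms by (simp add: g_def)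
    ultimately show ?thesis unfolding 1 2 using that L by (simp add: powr_mult mult_ac)
  qed
  \<comment> \<open>A non-negative integral yields integrability and value at once. The endpoints
    are added because the substitution rule works on closed intervals.\<close>
  have "(\<integral>\<^sup>+s. ennreal (?k s * indicator {r<..<t} s) \<partial>lborel)
      = (\<integral>\<^sup>+s. ?k s * indicator {g 0..g 1} s \<partial>lborel)"
    unfolding g0 g1
  proof (rule nn_integral_cong_AE)
    show "AE s in lborel. ennreal (?k s * indicator {r<..<t} s) = ennreal (?k s * indicator {r..t} s)"
      using AE_lborel_singleton[of r] AE_lborel_singleton[of t]
      by eventually_elim (auto simp: indicator_def)
  qed
  also have "\<dots> = (\<integral>\<^sup>+x. ?k (g x) * (L * g x) * indicator {0..1} x \<partial>lborel)"
    by (rule nn_integral_substitution)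
       (use assms L in \<open>auto simp: set_borel_measurable_def g_def
          intro!: derivative_eq_intros continuous_intros\<close>)
  also have "\<dots> = (\<integral>\<^sup>+x. ennreal (L powr (p + q - 1) * (x powr (q - 1) * (1 - x) powr (p - 1)))
                       * indicator {0..1} x \<partial>lborel)"
  proof (rule nn_integral_cong)
    fix x
    show "ennreal (?k (g x) * (L * g x) * indicator {0..1} x)
        = ennreal (L powr (p + q - 1) * (x powr (q - 1) * (1 - x) powr (p - 1))) * indicator {0..1} x"
    proof (cases "x \<in> {0..1}")
      case True
      show ?thesis unfolding eq[OF True] using True by simp
    qed simp
  qed
  also have "\<dots> = ennreal (L powr (p + q - 1) * Beta q p)"
    using assms by (intro nn_integral_has_integral_lebesgue' has_integral_mult_right has_integral_Beta_real) auto
  finally have *: "(\<integral>\<^sup>+s. ennreal (?k s * indicator {r<..<t} s) \<partial>lborel)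
      = ennreal (L powr (p + q - 1) * Beta q p)" .
  have "has_bochner_integral lborel (\<lambda>s. ?k s * indicator {r<..<t} s) (L powr (p + q - 1) * Beta q p)"
    by (rule has_bochner_integral_nn_integral[OF _ _ _ *])
       (use B assms in \<open>auto simp: indicator_def\<close>)
  then show "set_integrable lborel {r<..<t} ?k"
    and "(LINT s:{r<..<t}|lborel. ?k s) = ln (t / r) powr (p + q - 1) * Beta q p"
    unfolding has_bochner_integral_iff set_integrable_def set_lebesgue_integral_def L_def
    by (simp_all add: mult.commute)
qed

lemma hadamard_integral_1:
  assumes "0 < a"
  shows "hadamard_integral a 1 f t = (LINT s:{a<..<t}|lborel. f s / s)"
  using assms unfolding hadamard_integral_def
  by (auto intro!: set_lebesgue_integral_cong)

text \<open>Fubini on the triangle \<open>a < r < s < t\<close>: integrating out \<open>s\<close>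
  leaves \<open>Beta \<beta> \<alpha>\<close> times the kernel of order
  \<open>\<alpha> + \<beta>\<close>, and the Beta value cancels against the Gamma factors. The same
  computation with absolute values shows that existence at order \<open>\<alpha> + \<beta>\<close>
  makes the double integral absolutely convergent.\<close>

lemma hadamard_integral_semigroup:
  assumes "0 < a" "a < t" "0 < \<alpha>" "0 < \<beta>"
    and ex: "hadamard_integral_exists a (\<alpha> + \<beta>) f t"
  shows "hadamard_integral a \<alpha> (hadamard_integral a \<beta> f) t = hadamard_integral a (\<alpha> + \<beta>) f t"
proof -
  have Gamma_nz: "Gamma \<alpha> \<noteq> 0" "Gamma \<beta> \<noteq> 0" "Gamma (\<alpha> + \<beta>) \<noteq> 0"
    using assms by (auto dest: Gamma_real_pos simp: Gamma_eq_zero_iff elim!: nonpos_Ints_cases')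
  \<comment> \<open>\<open>G\<close> is integrable, so dividing by the kernel gives a measurable
    \<open>F\<close> that equals \<open>f r / r\<close> on \<open>(a, t)\<close>. This supplies the
    joint measurability required by Fubini.\<close>
  define G where "G r = indicator {a<..<t} r * (ln (t / r) powr (\<alpha> + \<beta> - 1) * f r / r)" for r
  define F where "F r = G r / ln (t / r) powr (\<alpha> + \<beta> - 1)" for r
  have G: "integrable lborel G"
    using ex assms unfolding hadamard_integral_exists_def set_integrable_def G_def by auto
  have [measurable]: "F \<in> borel_measurable borel"
    using borel_measurable_integrable[OF G] unfolding F_def by measurable
  have F: "F r = f r / r" if "a < r" "r < t" for r
    using that assms by (simp add: F_def G_def)
  define h where "h r s = (if a < r \<and> r < s \<and> s < t
    then F r * (ln (t / s) powr (\<alpha> - 1) * ln (s / r) powr (\<beta> - 1) / s) else 0)" for r s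
  have meas[measurable]: "case_prod h \<in> borel_measurable (borel \<Otimes>\<^sub>M borel)"
    unfolding h_def by measurable
  have h: "h r s = (indicator {a<..<t} r * F r) * (indicator {r<..<t} s *\<^sub>R
      (ln (t / s) powr (\<alpha> - 1) * ln (s / r) powr (\<beta> - 1) / s))" for r s
    by (auto simp: h_def indicator_def)
  have hint: "integrable lborel (h r)" for r
  proof (cases "a < r \<and> r < t")
    case True
    then show ?thesis using log_beta_kernel(1)[of r t \<alpha> \<beta>] assms
      unfolding h set_integrable_def by (intro integrable_mult_right) auto
  next
    case False
    then have "h r = (\<lambda>s. 0)" by (intro ext) (auto simp: h_def)
    then show ?thesis by simp
  qed
  have hval: "(\<integral>s. h r s \<partial>lborel) = G r * Beta \<beta> \<alpha>" for r
  proof (cases "a < r \<and> r < t")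
    case True
    have "(\<integral>s. h r s \<partial>lborel) = indicator {a<..<t} r * F r * (LINT s:{r<..<t}|lborel.
        ln (t / s) powr (\<alpha> - 1) * ln (s / r) powr (\<beta> - 1) / s)"
      unfolding h set_lebesgue_integral_def by (rule integral_mult_right_zero)
    then show ?thesis using True assms
      by (subst (asm) log_beta_kernel(2)) (auto simp: F G_def)
  qed (auto simp: h G_def)
  have hnorm: "(\<integral>s. norm (h r s) \<partial>lborel) = \<bar>G r\<bar> * Beta \<beta> \<alpha>" for r
  proof (cases "a < r \<and> r < t")
    case True
    have "(\<integral>s. norm (h r s) \<partial>lborel) = (\<integral>s. \<bar>indicator {a<..<t} r * F r\<bar> * (indicator {r<..<t} s *\<^sub>R
      (ln (t / s) powr (\<alpha> - 1) * ln (s / r) powr (\<beta> - 1) / s)) \<partial>lborel)"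
      using True assms by (intro Bochner_Integration.integral_cong refl) (auto simp: h abs_mult indicator_def)
    also have "\<dots> = \<bar>indicator {a<..<t} r * F r\<bar> * (LINT s:{r<..<t}|lborel.
        ln (t / s) powr (\<alpha> - 1) * ln (s / r) powr (\<beta> - 1) / s)"
      unfolding set_lebesgue_integral_def by (rule integral_mult_right_zero)
    finally show ?thesis using True assms
      by (subst (asm) log_beta_kernel(2)) (auto simp: F G_def abs_mult)
  qed (auto simp: h G_def)
  have "integrable (lborel \<Otimes>\<^sub>M lborel) (case_prod h)"
    using hint G by (intro lborel_pair.Fubini_integrable) (auto simp: hnorm[unfolded real_norm_def] integrable_abs)
  then have "(\<integral>s. (\<integral>r. h r s \<partial>lborel) \<partial>lborel) = (\<integral>r. (\<integral>s. h r s \<partial>lborel) \<partial>lborel)"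
    by (rule lborel_pair.Fubini_integral)
  also have "\<dots> = Beta \<beta> \<alpha> * (LINT r:{a<..<t}|lborel. ln (t / r) powr (\<alpha> + \<beta> - 1) * f r / r)"
    unfolding hval integral_mult_left_zero by (simp add: G_def[abs_def] set_lebesgue_integral_def)
  \<comment> \<open>In the other order the inner integral over \<open>r\<close> is the one defining
    \<open>hadamard_integral a \<beta> f s\<close>. Slices that are not integrable cause no
    discrepancy, since both sides are then 0.\<close>
  also have "(\<integral>s. (\<integral>r. h r s \<partial>lborel) \<partial>lborel)
      = (LINT s:{a<..<t}|lborel. Gamma \<beta> * (ln (t / s) powr (\<alpha> - 1) * hadamard_integral a \<beta> f s / s))"
    unfolding set_lebesgue_integral_def
  proof (intro Bochner_Integration.integral_cong refl)
    fix s
    show "(\<integral>r. h r s \<partial>lborel) = indicator {a<..<t} s *\<^sub>R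
        (Gamma \<beta> * (ln (t / s) powr (\<alpha> - 1) * hadamard_integral a \<beta> f s / s))"
    proof (cases "a < s \<and> s < t")
      case True
      have "(\<integral>r. h r s \<partial>lborel) = (\<integral>r. (ln (t / s) powr (\<alpha> - 1) / s) *
          (indicator {a<..<s} r *\<^sub>R (ln (s / r) powr (\<beta> - 1) * f r / r)) \<partial>lborel)"
        using True by (intro Bochner_Integration.integral_cong refl) (auto simp: h_def indicator_def F mult_ac)
      also have "\<dots> = (ln (t / s) powr (\<alpha> - 1) / s) *
          (LINT r:{a<..<s}|lborel. ln (s / r) powr (\<beta> - 1) * f r / r)"
        unfolding set_lebesgue_integral_def by (rule integral_mult_right_zero)
      finally show ?thesis using True assms Gamma_nz
        by (simp add: hadamard_integral_def)
    next
      case False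
      then have "h r s = 0" for r by (auto simp: h_def)
      with False show ?thesis by simp
    qed
  qed
  also have "\<dots> = Gamma \<beta> * (LINT s:{a<..<t}|lborel. ln (t / s) powr (\<alpha> - 1) * hadamard_integral a \<beta> f s / s)"
    by (rule set_integral_mult_right)
  finally have "Gamma \<beta> * (Gamma \<alpha> * hadamard_integral a \<alpha> (hadamard_integral a \<beta> f) t)
      = Beta \<beta> \<alpha> * (Gamma (\<alpha> + \<beta>) * hadamard_integral a (\<alpha> + \<beta>) f t)"
    using assms Gamma_nz
    by (simp add: hadamard_integral_def[of _ \<alpha>] hadamard_integral_def[of _ "\<alpha> + \<beta>"])
  then show ?thesis
    using Gamma_nz by (simp add: Beta_def add.commute)
qed

section \<open>Sup bound for Hadamard integrals\<close>

text \<open>Hoelder against the kernel: its \<open>q'\<close>-th power is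
  \<open>ln (t / s) powr (p - 1)\<close>, which is integrable up to \<open>s = t\<close> because
  \<open>\<alpha> > 1 / q\<close> makes \<open>p\<close> positive. Replacing
  \<open>ln (t / a)\<close> by \<open>ln (b / a)\<close> makes the constant uniform in
  \<open>t\<close>.\<close>

lemma hadamard_integral_bound:
  fixes a b q \<alpha> :: real
  assumes "0 < a" "a < b" "1 < q" "1 / q < \<alpha>"
  shows "\<exists>K>0. \<forall>g t. in_Llog q a b g \<and> a < t \<and> t < b \<longrightarrow>
           \<bar>hadamard_integral a \<alpha> g t\<bar> \<le> K * Llog_norm q a b g"
proof -
  define q' where "q' = q / (q - 1)"
  define p where "p = (\<alpha> - 1) * q' + 1"
  have \<alpha>: "0 < \<alpha>" using assms by (smt (verit) divide_pos_pos)
  have q': "1 < q'" "1 / q' + 1 / q = 1" using assms by (auto simp: q'_def field_simps)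
  have "p = (\<alpha> * q - 1) / (q - 1)" using assms by (simp add: p_def q'_def field_simps)
  moreover have "1 < \<alpha> * q" using assms by (simp add: field_simps)
  ultimately have p: "0 < p" using assms by simp
  \<comment> \<open>The summands are the two terms of Young's inequality after integration: the
    kernel term over \<open>q'\<close>, and the normalised \<open>q\<close>-th power of
    \<open>g\<close>, of integral at most 1, over \<open>q\<close>.\<close>
  define K where "K = (ln (b / a) powr p * Beta 1 p / q' + 1 / q) / Gamma \<alpha>"
  have G: "0 < Gamma \<alpha>" using \<alpha> by (rule Gamma_real_pos)
  have B: "0 < Beta 1 p" using p by (simp add: Beta_def Gamma_real_pos)
  have K: "0 < K" using assms q' B G unfolding K_def by (intro divide_pos_pos add_nonneg_pos) auto
  have "\<bar>hadamard_integral a \<alpha> g t\<bar> \<le> K * Llog_norm q a b g"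
    if g: "in_Llog q a b g" and t: "a < t" "t < b" for g t
  proof -
    define N where "N = Llog_norm q a b g"
    have N0: "0 \<le> N" by (simp add: N_def Lw_norm_def)
    have I: "set_integrable lborel {a<..<b} (\<lambda>s. \<bar>g s\<bar> powr q * (1 / s))"
      using g by (simp add: in_Lw_def)
    have I0: "0 \<le> (LINT s:{a<..<b}|lborel. \<bar>g s\<bar> powr q * (1 / s))"
      unfolding set_lebesgue_integral_def using assms
      by (intro Bochner_Integration.integral_nonneg) (auto simp: indicator_def)
    have NI: "N powr q = (LINT s:{a<..<b}|lborel. \<bar>g s\<bar> powr q * (1 / s))"
      using I0 assms by (simp add: N_def Lw_norm_def powr_powr)
    \<comment> \<open>Hoelder via Young's inequality for \<open>g / M\<close>; taking \<open>M > N\<close> avoids dividing by \<open>N = 0\<close>.\<close>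
    have le: "\<bar>hadamard_integral a \<alpha> g t\<bar> \<le> K * M" if M: "N < M" for M
    proof -
      have M0: "0 < M" using N0 M by simp
      \<comment> \<open>The factor with exponent \<open>1 - 1\<close> equals 1 inside the interval
        and brings the kernel into the form of \<open>log_beta_kernel\<close>.\<close>
      define k where "k s = ln (t / s) powr (p - 1) * ln (s / a) powr (1 - 1) / s" for s
      define H where "H s = M * (k s / q' + \<bar>g s\<bar> powr q * (1 / s) / M powr q / q)" for s
      have k: "set_integrable lborel {a<..<t} k" "(LINT s:{a<..<t}|lborel. k s) = ln (t / a) powr p * Beta 1 p"
        using log_beta_kernel[of a t p 1] assms t p unfolding k_def by simp_all
      have It: "set_integrable lborel {a<..<t} (\<lambda>s. \<bar>g s\<bar> powr q * (1 / s))"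
        by (rule set_integrable_subset[OF I]) (use t in auto)
      have H: "set_integrable lborel {a<..<t} H" unfolding H_def
        by (intro set_integrable_mult_right set_integral_add(1) set_integrable_divide k(1) It)
      have "(LINT s:{a<..<t}|lborel. \<bar>g s\<bar> powr q * (1 / s)) \<le> N powr q"
        unfolding NI set_lebesgue_integral_def
        using I It t assms unfolding set_integrable_def
        by (intro integral_mono) (auto simp: indicator_def)
      also have "\<dots> \<le> M powr q" using M N0 assms by (intro powr_mono2) auto
      finally have "(LINT s:{a<..<t}|lborel. \<bar>g s\<bar> powr q * (1 / s)) / M powr q \<le> 1"
        using M0 by (simp add: divide_le_eq)
      then have J: "(LINT s:{a<..<t}|lborel. \<bar>g s\<bar> powr q * (1 / s)) / M powr q / q \<le> 1 / q"
        using assms by (intro divide_right_mono) auto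
      have L: "ln (t / a) powr p * Beta 1 p / q' \<le> ln (b / a) powr p * Beta 1 p / q'"
        using assms t p B q' by (intro divide_right_mono mult_right_mono powr_mono2) (auto simp: divide_right_mono)
      have "(LINT s:{a<..<t}|lborel. H s) = M * (ln (t / a) powr p * Beta 1 p / q' +
             (LINT s:{a<..<t}|lborel. \<bar>g s\<bar> powr q * (1 / s)) / M powr q / q)"
        unfolding H_def
        by (simp only: set_integral_mult_right set_integral_divide_zero k(2)
              set_integral_add(2)[OF set_integrable_divide[OF k(1)]
                set_integrable_divide[OF set_integrable_divide[OF It]]])
      also have "\<dots> \<le> M * (ln (b / a) powr p * Beta 1 p / q' + 1 / q)"
        using M0 J L by (intro mult_left_mono add_mono) auto
      finally have HK: "(LINT s:{a<..<t}|lborel. H s) \<le> Gamma \<alpha> * (K * M)"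
        using G by (simp add: K_def mult_ac)
      have bnd: "\<bar>ln (t / s) powr (\<alpha> - 1) * g s / s\<bar> \<le> H s" if s: "s \<in> {a<..<t}" for s
      proof -
        have "ln (t / s) powr (\<alpha> - 1) * (\<bar>g s\<bar> / M)
           \<le> (ln (t / s) powr (\<alpha> - 1)) powr q' / q' + (\<bar>g s\<bar> / M) powr q / q"
          using q' assms M0 by (intro Youngs_inequality) auto
        also have "\<dots> = ln (t / s) powr (p - 1) / q' + \<bar>g s\<bar> powr q / M powr q / q"
          using M0 by (simp add: powr_powr p_def powr_divide)
        finally have "ln (t / s) powr (\<alpha> - 1) * (\<bar>g s\<bar> / M) * (M / s)
          \<le> (ln (t / s) powr (p - 1) / q' + \<bar>g s\<bar> powr q / M powr q / q) * (M / s)"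
          using s assms M0 by (intro mult_right_mono) auto
        also have "\<dots> = H s" using s assms by (simp add: H_def k_def field_simps)
        finally show ?thesis using s assms M0 by (simp add: abs_mult)
      qed
      have "\<bar>LINT s:{a<..<t}|lborel. ln (t / s) powr (\<alpha> - 1) * g s / s\<bar> \<le> (LINT s:{a<..<t}|lborel. H s)"
      proof (cases "set_integrable lborel {a<..<t} (\<lambda>s. ln (t / s) powr (\<alpha> - 1) * g s / s)")
        case True
        then show ?thesis using H bnd unfolding set_lebesgue_integral_def set_integrable_def
          by (intro integral_abs_bound_integral) (auto simp: indicator_def)
      next
        \<comment> \<open>The integral then has its default value 0, and the majorant
          \<open>H\<close> is non-negative.\<close>
        case False
        have "0 \<le> H s" if "s \<in> {a<..<t}" for s using bnd[OF that] by linarith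
        then have "0 \<le> (LINT s:{a<..<t}|lborel. H s)"
          unfolding set_lebesgue_integral_def
          by (intro Bochner_Integration.integral_nonneg) (auto simp: indicator_def)
        then show ?thesis using False unfolding set_lebesgue_integral_def set_integrable_def
          by (simp add: not_integrable_integral_eq)
      qed
      also note HK
      finally show ?thesis using G \<alpha> by (simp add: hadamard_integral_def abs_mult divide_le_eq mult_ac)
    qed
    have "\<bar>hadamard_integral a \<alpha> g t\<bar> / K \<le> N"
      by (rule dense_ge) (use le K in \<open>simp add: divide_le_eq mult.commute\<close>)
    then show ?thesis using K by (simp add: N_def divide_le_eq mult.commute)
  qed
  with K show ?thesis by blast
qed

section \<open>Removing the weight \<open>1 / s\<close>\<close>

text \<open>Only signed primitives of \<open>f s / s\<close> are controlled, so the weight cannot be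
  removed under an absolute value. Instead \<open>f s = s * (f s / s)\<close> with the monotone
  factor \<open>s\<close>, to which the second mean value theorem applies.\<close>

lemma set_integral_bound_by_log_primitive:
  fixes a t M :: real
  assumes "0 < a" "a < t"
    and f: "set_integrable lborel {a<..<t} f"
    and M: "\<And>c. a \<le> c \<Longrightarrow> c \<le> t \<Longrightarrow> \<bar>LINT s:{a<..<c}|lborel. f s / s\<bar> \<le> M"
  shows "\<bar>LINT s:{a<..<t}|lborel. f s\<bar> \<le> (a + 2 * t) * M"
proof -
  have w: "set_integrable lborel {a<..<t} (\<lambda>s. f s / s)"
  proof (rule set_integrable_bound[where f = "\<lambda>s. f s / a"])
    show "set_integrable lborel {a<..<t} (\<lambda>s. f s / a)" using f by simp
    have "(\<lambda>s. (indicator {a<..<t} s *\<^sub>R f s) / s) \<in> borel_measurable lborel"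
      using f unfolding set_integrable_def by measurable
    then show "set_borel_measurable lborel {a<..<t} (\<lambda>s. f s / s)"
      by (simp add: set_borel_measurable_def)
    show "AE s in lborel. s \<in> {a<..<t} \<longrightarrow> norm (f s / s) \<le> norm (f s / a)"
      using assms by (auto intro!: AE_I2 simp: divide_left_mono)
  qed
  \<comment> \<open>The second mean value theorem concerns Henstock-Kurzweil integrals over closed
    intervals, so the Lebesgue integrals are converted.\<close>
  have wc: "integral {a..c} (\<lambda>s. f s / s) = (LINT s:{a<..<c}|lborel. f s / s)" if "c \<le> t" for c
  proof -
    have "set_integrable lborel {a<..<c} (\<lambda>s. f s / s)"
      by (rule set_integrable_subset[OF w]) (use that in auto)
    from set_borel_integral_eq_integral(2)[OF this] show ?thesis
      by (simp only: integral_open_interval_real)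
  qed
  have wi: "(\<lambda>s. f s / s) integrable_on {a..t}"
    using set_borel_integral_eq_integral(1)[OF w] by (simp add: integrable_on_Icc_iff_Ioo)
  obtain c where c: "c \<in> {a..t}" and eq: "integral {a..t} (\<lambda>s. s * (f s / s))
      = a * integral {a..c} (\<lambda>s. f s / s) + t * integral {c..t} (\<lambda>s. f s / s)"
    by (rule second_mean_value_theorem[OF wi, of "\<lambda>s. s"]) (use assms in auto)
  have "(LINT s:{a<..<t}|lborel. f s) = integral {a..t} f"
    using set_borel_integral_eq_integral(2)[OF f] by (simp add: integral_open_interval_real)
  also have "\<dots> = integral {a..t} (\<lambda>s. s * (f s / s))"
    using assms by (intro integral_cong) auto
  also note eq
  \<comment> \<open>The tail is a difference of two primitives, each bounded by \<open>M\<close>;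
    hence the factor 2 in the constant.\<close>
  also have "integral {c..t} (\<lambda>s. f s / s)
      = integral {a..t} (\<lambda>s. f s / s) - integral {a..c} (\<lambda>s. f s / s)"
    using Henstock_Kurzweil_Integration.integral_combine[OF _ _ wi, of c] c by simp
  finally have eq': "(LINT s:{a<..<t}|lborel. f s) =
      a * integral {a..c} (\<lambda>s. f s / s) + t * (integral {a..t} (\<lambda>s. f s / s) - integral {a..c} (\<lambda>s. f s / s))" .
  have bc: "\<bar>integral {a..c} (\<lambda>s. f s / s)\<bar> \<le> M" "\<bar>integral {a..t} (\<lambda>s. f s / s)\<bar> \<le> M"
    using M[of c] M[of t] c assms by (simp_all add: wc)
  have "\<bar>LINT s:{a<..<t}|lborel. f s\<bar> \<le> \<bar>a * integral {a..c} (\<lambda>s. f s / s)\<bar>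
      + \<bar>t * (integral {a..t} (\<lambda>s. f s / s) - integral {a..c} (\<lambda>s. f s / s))\<bar>"
    unfolding eq' by (rule abs_triangle_ineq)
  also have "\<dots> \<le> a * M + t * (2 * M)"
    unfolding abs_mult using bc assms by (intro add_mono mult_mono) auto
  finally show ?thesis by (simp add: algebra_simps)
qed


section \<open>Recovering \<open>u\<close> from its derivative\<close>

text \<open>Local absolute continuity gives no integrability up to the endpoint \<open>a\<close>.
  For \<alpha> = 1 it follows from L^q being contained in L^1 on a bounded interval, for \<alpha> <
  1 from the existence of the fractional integral at a single point beyond \<open>t\<close>.\<close>

lemma set_integrable_deriv_of_hadamard_deriv:
  fixes a b q \<alpha> t :: real
  assumes "0 < a" "1 \<le> q" "0 < \<alpha>" "\<alpha> \<le> 1"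
    and ex: "hadamard_deriv_exists a b \<alpha> u"
    and D: "in_Llog q a b (hadamard_deriv a \<alpha> u)"
    and t: "a < t" "t < b"
  shows "set_integrable lborel {a<..<t} (deriv u)"
proof (cases "\<alpha> = 1")
  case True
  have D': "hadamard_deriv a \<alpha> u = deriv u"
    using True by (simp add: hadamard_deriv_def hadamard_integral_def fun_eq_iff)
  have "set_integrable lborel {a<..<b} (deriv u)"
  proof (rule set_integrable_bound)
    \<comment> \<open>The majorant comes from
      \<open>\<bar>y\<bar> \<le> 1 + \<bar>y\<bar> powr q\<close> and
      \<open>1 \<le> b / s\<close>.\<close>
    show "set_integrable lborel {a<..<b} (\<lambda>s. 1 + b * (\<bar>deriv u s\<bar> powr q * (1 / s)))"
      using D t unfolding in_Lw_def D'
      by (intro set_integral_add(1) set_integrable_mult_right)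
         (auto simp: set_integrable_def intro!: integrable_real_indicator)
    show "set_borel_measurable lborel {a<..<b} (deriv u)"
      using D unfolding in_Lw_def D' by simp
    show "AE s in lborel. s \<in> {a<..<b} \<longrightarrow>
        norm (deriv u s) \<le> norm (1 + b * (\<bar>deriv u s\<bar> powr q * (1 / s)))"
    proof (intro AE_I2 impI)
      fix s assume s: "s \<in> {a<..<b}"
      have "\<bar>deriv u s\<bar> \<le> 1 + \<bar>deriv u s\<bar> powr q"
      proof (cases "\<bar>deriv u s\<bar> \<le> 1")
        case False
        then have "\<bar>deriv u s\<bar> powr 1 \<le> \<bar>deriv u s\<bar> powr q"
          using assms by (intro powr_mono) auto
        then show ?thesis by simp
      qed (simp add: add_increasing2)
      also have "\<dots> \<le> 1 + (b / s) * \<bar>deriv u s\<bar> powr q"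
        using s assms mult_right_mono[of 1 "b / s" "\<bar>deriv u s\<bar> powr q"] by simp
      finally show "norm (deriv u s) \<le> norm (1 + b * (\<bar>deriv u s\<bar> powr q * (1 / s)))"
        by simp
    qed
  qed
  then show ?thesis by (rule set_integrable_subset) (use t in auto)
next
  case False
  \<comment> \<open>On \<open>(a, t)\<close> the kernel \<open>ln (r / s) powr (- \<alpha>)\<close> with \<open>r > t\<close> is bounded away from 0.\<close>
  have ae: "AE r in lborel. a < r \<and> r < b \<longrightarrow> hadamard_integral_exists a (1 - \<alpha>) (deriv u) r"
    using ex by (simp add: hadamard_deriv_exists_def)
  \<comment> \<open>Existence holds almost everywhere and \<open>(t, b)\<close> has positive
    measure.\<close>
  obtain r where r: "t < r" "r < b" "hadamard_integral_exists a (1 - \<alpha>) (deriv u) r"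
  proof (rule ccontr)
    assume "\<not> thesis"
    with that have "\<not> hadamard_integral_exists a (1 - \<alpha>) (deriv u) r" if "t < r" "r < b" for r
      using that by blast
    with ae have "AE r in lborel. r \<notin> {t<..<b}"
      using t by (auto elim!: eventually_mono)
    then have "{t<..<b} \<in> null_sets lborel"
      by (subst AE_iff_null_sets) auto
    then show False using t by (auto simp: null_sets_def)
  qed
  define k where "k s = ln (r / s) powr (- \<alpha>) * deriv u s / s" for s
  have "set_integrable lborel {a<..<r} k"
    using r False by (simp add: hadamard_integral_exists_def k_def[abs_def])
  then have k: "set_integrable lborel {a<..<t} k"
    by (rule set_integrable_subset) (use r in auto)
  have eq: "deriv u s = k s * (s * ln (r / s) powr \<alpha>)" if "s \<in> {a<..<t}" for s
    using that assms r by (simp add: k_def powr_minus)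
  have "set_integrable lborel {a<..<t} (\<lambda>s. k s * (s * ln (r / s) powr \<alpha>))"
  proof (rule set_integrable_bound)
    show "set_integrable lborel {a<..<t} (\<lambda>s. k s * (t * ln (r / a) powr \<alpha>))"
      using k by simp
    have "(\<lambda>s. (indicator {a<..<t} s *\<^sub>R k s) * (s * ln (r / s) powr \<alpha>)) \<in> borel_measurable lborel"
      using k unfolding set_integrable_def by measurable
    then show "set_borel_measurable lborel {a<..<t} (\<lambda>s. k s * (s * ln (r / s) powr \<alpha>))"
      by (simp add: set_borel_measurable_def mult.assoc)
    show "AE s in lborel. s \<in> {a<..<t} \<longrightarrow>
        norm (k s * (s * ln (r / s) powr \<alpha>)) \<le> norm (k s * (t * ln (r / a) powr \<alpha>))"
    proof (intro AE_I2 impI)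
      fix s assume s: "s \<in> {a<..<t}"
      then have "s * ln (r / s) powr \<alpha> \<le> t * ln (r / a) powr \<alpha>"
        using assms r by (intro mult_mono powr_mono2) (auto simp: divide_left_mono)
      then show "norm (k s * (s * ln (r / s) powr \<alpha>)) \<le> norm (k s * (t * ln (r / a) powr \<alpha>))"
        using s assms t by (simp add: abs_mult mult_left_mono)
    qed
  qed
  then show ?thesis
    by (subst set_integrable_cong[OF refl refl eq]) auto
qed

text \<open>Let \<open>c\<close> tend to \<open>a\<close> in the fundamental theorem on
  \<open>[c, t]\<close>: integrability near \<open>a\<close> makes the integrals converge, and
  \<open>u(a+) = 0\<close> removes the constant of integration.\<close>

lemma locally_abs_cont_eq_integral:
  fixes a b t :: real
  assumes lac: "locally_abs_cont a b u" and lim: "(u \<longlongrightarrow> 0) (at_right a)"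
    and I: "set_integrable lborel {a<..<t} (deriv u)"
    and t: "a < t" "t < b"
  shows "u t = (LINT s:{a<..<t}|lborel. deriv u s)"
proof -
  have eq: "{a<..t} = {a<..<t} \<union> {t}" using t by auto
  have "set_integrable lborel {a<..t} (deriv u)"
    unfolding eq by (rule set_integrable_Un[OF I]) auto
  then have "((\<lambda>c. LINT s:{c..t}|lborel. deriv u s) \<longlongrightarrow> (LINT s:{a<..t}|lborel. deriv u s)) (at_right a)"
    using t by (intro tendsto_set_lebesgue_integral_at_right) auto
  moreover have "eventually (\<lambda>c. (LINT s:{c..t}|lborel. deriv u s) = u t - u c) (at_right a)"
    using lac t unfolding locally_abs_cont_def eventually_at_right_field by (intro exI[of _ t]) auto
  then have "((\<lambda>c. LINT s:{c..t}|lborel. deriv u s) \<longlongrightarrow> u t - 0) (at_right a)"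
    by (rule tendsto_cong[THEN iffD2]) (intro tendsto_intros lim)
  ultimately have "u t - 0 = (LINT s:{a<..t}|lborel. deriv u s)"
    using tendsto_unique trivial_limit_at_right_real by blast
  also have "\<dots> = (LINT s:{a<..<t}|lborel. deriv u s)"
    by (rule set_integral_discrete_difference[of "{t}"]) (use t in auto)
  finally show ?thesis by simp
qed

section \<open>Sup bound for \<open>u\<close>\<close>

lemma hadamard_deriv_sup_bound:
  fixes a b q \<alpha> :: real
  assumes "0 < a" "a < b" "1 \<le> q" "1 / q < \<alpha>" "\<alpha> \<le> 1"
  shows "\<exists>K>0. \<forall>u t. hadamard_deriv_exists a b \<alpha> u \<and> (u \<longlongrightarrow> 0) (at_right a) \<and>
           in_Llog q a b (hadamard_deriv a \<alpha> u) \<and> a < t \<and> t < b \<longrightarrow>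
           \<bar>u t\<bar> \<le> K * Llog_norm q a b (hadamard_deriv a \<alpha> u)"
proof -
  have \<alpha>: "0 < \<alpha>" using assms by (smt (verit) divide_pos_pos)
  \<comment> \<open>The value \<open>q = 1\<close> is excluded by \<open>1 / q < \<alpha>\<close>
    and \<open>\<alpha> \<le> 1\<close>, so the Hoelder estimate applies.\<close>
  have q: "1 < q" using assms by (cases "q = 1") auto
  obtain K where K: "0 < K" and bound: "\<And>g t. in_Llog q a b g \<Longrightarrow> a < t \<Longrightarrow> t < b \<Longrightarrow>
      \<bar>hadamard_integral a \<alpha> g t\<bar> \<le> K * Llog_norm q a b g"
    using hadamard_integral_bound[of a b q \<alpha>] assms q by blast
  have "\<bar>u t\<bar> \<le> ((a + 2 * b) * K) * Llog_norm q a b (hadamard_deriv a \<alpha> u)"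
    if ex: "hadamard_deriv_exists a b \<alpha> u" and lim: "(u \<longlongrightarrow> 0) (at_right a)"
      and D: "in_Llog q a b (hadamard_deriv a \<alpha> u)" and t: "a < t" "t < b" for u t
  proof -
    define N where "N = Llog_norm q a b (hadamard_deriv a \<alpha> u)"
    have N0: "0 \<le> N" by (simp add: N_def Lw_norm_def)
    have I: "set_integrable lborel {a<..<c} (deriv u)" if "a < c" "c < b" for c
      using set_integrable_deriv_of_hadamard_deriv[OF _ _ \<alpha> _ ex D that] assms by simp
    \<comment> \<open>This primitive is the Hadamard integral of order 1 of \<open>u'\<close>, which
      factors as order \<alpha> after order \<open>1 - \<alpha>\<close>. The case \<alpha> = 1 is
      separate because the semigroup law is for positive orders.\<close>
    have prim: "\<bar>LINT s:{a<..<c}|lborel. deriv u s / s\<bar> \<le> K * N" if c: "a \<le> c" "c \<le> t" for c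
    proof (cases "c = a")
      case True
      then show ?thesis using K N0 by (simp add: set_lebesgue_integral_def)
    next
      case False
      with c t have c': "a < c" "c < b" by auto
      have "(LINT s:{a<..<c}|lborel. deriv u s / s) = hadamard_integral a 1 (deriv u) c"
        using assms by (simp add: hadamard_integral_1)
      also have "\<dots> = hadamard_integral a \<alpha> (hadamard_deriv a \<alpha> u) c"
      proof (cases "\<alpha> = 1")
        case True
        then have "hadamard_deriv a \<alpha> u = deriv u"
          by (simp add: hadamard_deriv_def hadamard_integral_def fun_eq_iff)
        with True show ?thesis by simp
      next
        case False
        \<comment> \<open>The orders add up to 1, so the kernel is
          \<open>ln (c / s) powr 0 = 1\<close> inside the interval, and \<open>deriv u s / a\<close>
          dominates.\<close>
        have "hadamard_integral_exists a (\<alpha> + (1 - \<alpha>)) (deriv u) c"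
        proof -
          have "set_integrable lborel {a<..<c} (\<lambda>s. ln (c / s) powr 0 * deriv u s / s)"
          proof (rule set_integrable_bound)
            show "set_integrable lborel {a<..<c} (\<lambda>s. deriv u s / a)" using I[OF c'] by simp
            have "(\<lambda>s. ln (c / s) powr 0 * (indicator {a<..<c} s *\<^sub>R deriv u s) / s) \<in> borel_measurable lborel"
              using I[OF c'] unfolding set_integrable_def by measurable
            then show "set_borel_measurable lborel {a<..<c} (\<lambda>s. ln (c / s) powr 0 * deriv u s / s)"
              by (simp add: set_borel_measurable_def mult_ac)
            show "AE s in lborel. s \<in> {a<..<c} \<longrightarrow>
                norm (ln (c / s) powr 0 * deriv u s / s) \<le> norm (deriv u s / a)"
              using assms by (auto intro!: AE_I2 divide_left_mono simp: abs_mult)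
          qed
          then show ?thesis by (simp add: hadamard_integral_exists_def)
        qed
        from hadamard_integral_semigroup[OF _ c'(1) \<alpha> _ this] show ?thesis
          using assms False by (simp add: hadamard_deriv_def)
      qed
      finally show ?thesis using bound[OF D c'] by (simp add: N_def)
    qed
    have "\<bar>u t\<bar> = \<bar>LINT s:{a<..<t}|lborel. deriv u s\<bar>"
      using locally_abs_cont_eq_integral[OF _ lim I[OF t] t] ex by (simp add: hadamard_deriv_exists_def)
    also have "\<dots> \<le> (a + 2 * t) * (K * N)"
      using assms t prim by (intro set_integral_bound_by_log_primitive I) auto
    also have "\<dots> \<le> (a + 2 * b) * (K * N)"
      using t K N0 by (intro mult_right_mono) auto
    finally show ?thesis by (simp add: N_def mult.assoc)
  qed
  moreover have "0 < (a + 2 * b) * K" using assms K by simp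
  ultimately show ?thesis by blast
qed

section \<open>Interpolation between the sup norm and L^p\<close>

text \<open>Bound \<open>\<gamma> * s\<close> of the \<gamma> powers of \<open>\<bar>u\<bar>\<close>
  by \<open>M\<close> and apply Hoelder against the constant 1 to the remaining
  \<open>\<gamma> * (1 - s)\<close>. The relation between the exponents makes the resulting power of
  \<open>b - a\<close> equal to \<open>s / q\<close>.\<close>

lemma L_norm_interpolation_sup:
  fixes a b p q s \<gamma> M :: real
  assumes "a < b" "0 < p" "0 < q" "0 \<le> s" "s \<le> 1"
    and \<gamma>: "\<gamma> * s / q + \<gamma> * (1 - s) / p = 1"
    and u: "in_L p a b u" and M: "\<And>t. a < t \<Longrightarrow> t < b \<Longrightarrow> \<bar>u t\<bar> \<le> M"
  shows "in_L \<gamma> a b u \<and>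
    L_norm \<gamma> a b u \<le> (b - a) powr (s / q) * M powr s * L_norm p a b u powr (1 - s)"
proof -
  define I where "I = (LINT t:{a<..<b}|lborel. \<bar>u t\<bar> powr p)"
  have meas: "set_borel_measurable lborel {a<..<b} u"
    and int: "set_integrable lborel {a<..<b} (\<lambda>t. \<bar>u t\<bar> powr p)"
    using u by (simp_all add: in_Lw_def)
  have "0 < \<gamma>"
  proof (rule ccontr)
    assume "\<not> 0 < \<gamma>"
    then have "\<gamma> * s / q \<le> 0" "\<gamma> * (1 - s) / p \<le> 0"
      using assms by (auto simp: divide_le_0_iff mult_le_0_iff)
    with \<gamma> show False by linarith
  qed
  have "(\<lambda>t. \<bar>indicator {a<..<b} t *\<^sub>R u t\<bar> powr \<gamma>) \<in> borel_measurable lborel"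
    using meas unfolding set_borel_measurable_def by measurable
  moreover have "(\<lambda>t. \<bar>indicator {a<..<b} t *\<^sub>R u t\<bar> powr \<gamma>)
      = (\<lambda>t. indicator {a<..<b} t *\<^sub>R (\<bar>u t\<bar> powr \<gamma>))"
    by (auto simp: indicator_def)
  ultimately have meas\<gamma>: "set_borel_measurable lborel {a<..<b} (\<lambda>t. \<bar>u t\<bar> powr \<gamma>)"
    by (simp only: set_borel_measurable_def)
  \<comment> \<open>Chosen so that \<open>\<bar>u t\<bar> powr (\<gamma> * (1 - s))\<close> is the
    \<theta>-th power of \<open>\<bar>u t\<bar> powr p\<close>.\<close>
  define \<theta> where "\<theta> = \<gamma> * (1 - s) / p"
  have \<theta>: "0 \<le> \<theta>" "\<theta> \<le> 1" "1 - \<theta> = \<gamma> * s / q"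
  proof -
    show 1: "1 - \<theta> = \<gamma> * s / q" using \<gamma> by (simp add: \<theta>_def)
    show "0 \<le> \<theta>" using assms \<open>0 < \<gamma>\<close> by (simp add: \<theta>_def)
    have "0 \<le> \<gamma> * s / q" using assms \<open>0 < \<gamma>\<close> by simp
    with 1 show "\<theta> \<le> 1" by linarith
  qed
  have \<theta>\<gamma>: "\<theta> / \<gamma> = (1 - s) / p" "(1 - \<theta>) / \<gamma> = s / q"
    using \<open>0 < \<gamma>\<close> unfolding \<theta>(3) by (simp_all add: \<theta>_def)
  have I0: "0 \<le> I"
    unfolding I_def set_lebesgue_integral_def by (intro Bochner_Integration.integral_nonneg) simp
  show ?thesis
  proof (cases "I = 0 \<or> M \<le> 0") \<comment> \<open>separate because of \<open>0 powr 0 = 0\<close>\<close>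
    case True
    have "AE t in lborel. indicator {a<..<b} t *\<^sub>R (\<bar>u t\<bar> powr \<gamma>) = 0"
    proof (cases "M \<le> 0")
      case True
      then show ?thesis using M by (intro AE_I2) (force simp: indicator_def)
    next
      case False
      with True have "I = 0" by simp
      then have "AE t in lborel. indicator {a<..<b} t *\<^sub>R (\<bar>u t\<bar> powr p) = 0"
        using int unfolding I_def set_lebesgue_integral_def set_integrable_def
        by (subst (asm) integral_nonneg_eq_0_iff_AE) auto
      then show ?thesis by eventually_elim auto
    qed
    moreover note meas\<gamma>[unfolded set_borel_measurable_def]
    ultimately have "integrable lborel (\<lambda>t. indicator {a<..<b} t *\<^sub>R (\<bar>u t\<bar> powr \<gamma>))"
      and "(\<integral>t. indicator {a<..<b} t *\<^sub>R (\<bar>u t\<bar> powr \<gamma>) \<partial>lborel) = 0"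
      by (simp_all add: integrable_cong_AE[of _ _ "\<lambda>_. 0"] integral_eq_zero_AE)
    then show ?thesis using meas
      by (simp add: in_Lw_def Lw_norm_def set_integrable_def set_lebesgue_integral_def)
  next
    case False
    then have "0 < I" "0 < M" using I0 by auto
    \<comment> \<open>\<open>N\<close> is the mean of \<open>\<bar>u\<bar> powr p\<close> over
      \<open>(a, b)\<close>. After division by it, the convex combination in \<open>H\<close> has
      mean 1, so \<open>H\<close> integrates to \<open>c * (b - a)\<close>.\<close>
    define N where "N = I / (b - a)"
    have "0 < N" using \<open>0 < I\<close> assms by (simp add: N_def)
    define c where "c = M powr (\<gamma> * s) * N powr \<theta>"
    define H where "H t = c * (\<theta> * (\<bar>u t\<bar> powr p / N) + (1 - \<theta>))" for t
    have const: "set_integrable lborel {a<..<b} (\<lambda>_. 1 - \<theta>)"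
      using assms by (auto simp: set_integrable_def intro!: integrable_real_indicator)
    have H: "set_integrable lborel {a<..<b} H"
      unfolding H_def
      by (intro set_integrable_mult_right set_integral_add(1) set_integrable_divide int const)
    have "(LINT t:{a<..<b}|lborel. H t) = c * (\<theta> * (I / N) + (LINT t:{a<..<b}|lborel. 1 - \<theta>))"
      unfolding H_def I_def
      by (simp only: set_integral_mult_right set_integral_divide_zero
          set_integral_add(2)[OF set_integrable_mult_right[OF set_integrable_divide[OF int]] const])
    also have "I / N = b - a" using \<open>0 < I\<close> by (simp add: N_def)
    also have "(LINT t:{a<..<b}|lborel. 1 - \<theta>) = (1 - \<theta>) * (b - a)"
      using assms by (simp add: set_lebesgue_integral_def)
    also have "c * (\<theta> * (b - a) + (1 - \<theta>) * (b - a)) = c * (b - a)"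
      by (simp add: algebra_simps)
    finally have HI: "(LINT t:{a<..<b}|lborel. H t) = c * (b - a)" .
    have bnd: "\<bar>u t\<bar> powr \<gamma> \<le> H t" if t: "t \<in> {a<..<b}" for t
    proof (cases "u t = 0")
      case True
      then show ?thesis using \<theta>(1,2) by (simp add: H_def c_def)
    next
      case False
      have "p * \<theta> = \<gamma> * (1 - s)" using assms by (simp add: \<theta>_def)
      then have "\<gamma> * s + p * \<theta> = \<gamma>" by (simp add: algebra_simps)
      then have "\<bar>u t\<bar> powr \<gamma> = \<bar>u t\<bar> powr (\<gamma> * s) * \<bar>u t\<bar> powr (p * \<theta>)"
        by (simp flip: powr_add)
      also have "\<dots> \<le> M powr (\<gamma> * s) * \<bar>u t\<bar> powr (p * \<theta>)"
        using M[of t] t assms \<open>0 < \<gamma>\<close> by (intro mult_right_mono powr_mono2) auto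
      \<comment> \<open>Young's inequality with weights \<theta> and \<open>1 - \<theta>\<close> is
        then applied to \<open>\<bar>u t\<bar> powr p / N\<close> and 1; both are positive, as zeros
        of \<open>u\<close> were treated separately.\<close>
      also have "\<bar>u t\<bar> powr (p * \<theta>) = N powr \<theta> * ((\<bar>u t\<bar> powr p / N) powr \<theta> * 1 powr (1 - \<theta>))"
        using \<open>0 < N\<close> by (simp add: powr_powr powr_divide)
      also have "M powr (\<gamma> * s) * \<dots>
          \<le> M powr (\<gamma> * s) * (N powr \<theta> * (\<theta> * (\<bar>u t\<bar> powr p / N) + (1 - \<theta>) * 1))"
        using \<theta> \<open>0 < N\<close> False by (intro mult_left_mono Youngs_inequality_0) auto
      finally show ?thesis by (simp add: H_def c_def mult.assoc)
    qed
    have int\<gamma>: "set_integrable lborel {a<..<b} (\<lambda>t. \<bar>u t\<bar> powr \<gamma>)"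
    proof (rule set_integrable_bound[OF H meas\<gamma>])
      show "AE t in lborel. t \<in> {a<..<b} \<longrightarrow> norm (\<bar>u t\<bar> powr \<gamma>) \<le> norm (H t)"
        using bnd by (intro AE_I2) force
    qed
    have "(LINT t:{a<..<b}|lborel. \<bar>u t\<bar> powr \<gamma>) \<le> c * (b - a)"
      unfolding HI[symmetric] using int\<gamma> H bnd by (rule set_integral_mono)
    moreover have "0 \<le> (LINT t:{a<..<b}|lborel. \<bar>u t\<bar> powr \<gamma>)"
      unfolding set_lebesgue_integral_def by (intro Bochner_Integration.integral_nonneg) simp
    ultimately have "L_norm \<gamma> a b u \<le> (c * (b - a)) powr (1 / \<gamma>)"
      unfolding Lw_norm_def using \<open>0 < \<gamma>\<close> by (simp add: powr_mono2)
    also have "c * (b - a) = M powr (\<gamma> * s) * (I powr \<theta> * (b - a) powr (1 - \<theta>))"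
      using assms \<open>0 < I\<close> by (simp add: c_def N_def powr_divide powr_diff)
    also have "\<dots> powr (1 / \<gamma>) = M powr s * (I powr ((1 - s) / p) * (b - a) powr (s / q))"
      using \<open>0 < \<gamma>\<close> by (simp add: powr_mult powr_powr \<theta>\<gamma>[symmetric])
    also have "I powr ((1 - s) / p) = L_norm p a b u powr (1 - s)"
      by (simp add: Lw_norm_def I_def powr_powr)
    finally show ?thesis using meas int\<gamma> by (simp add: in_Lw_def mult_ac)
  qed
qed

text \<open>The condition \<open>u(a+) = 0\<close> rules out nonzero constants, whose derivative
  vanishes and which violate the inequality for \<open>s > 0\<close>. Membership in L^\<gamma> is
  part of the conclusion because the norm of a non-integrable function would be 0 by
  default.\<close>

theorem theorem5p8:
  fixes a b p q \<alpha> s \<gamma> :: real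
  assumes "0 < a" and "a < b"
    and "1 \<le> p" and "1 \<le> q"
    and "1 / q < \<alpha>" and "\<alpha> \<le> 1"
    and "0 \<le> s" and "s \<le> 1"
    and "\<gamma> * s / q + \<gamma> * (1 - s) / p = 1"
  shows "\<exists>C>0. \<forall>u :: real \<Rightarrow> real.
           hadamard_deriv_exists a b \<alpha> u \<and>
           (u \<longlongrightarrow> 0) (at_right a) \<and>
           in_Llog q a b (hadamard_deriv a \<alpha> u) \<and>
           in_L p a b u \<longrightarrow>
             in_L \<gamma> a b u \<and>
             L_norm \<gamma> a b u
               \<le> C * Llog_norm q a b (hadamard_deriv a \<alpha> u) powr s * L_norm p a b u powr (1 - s)"
proof -
  obtain K where K: "0 < K" and bound: "\<And>u t. hadamard_deriv_exists a b \<alpha> u \<Longrightarrow>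
      (u \<longlongrightarrow> 0) (at_right a) \<Longrightarrow> in_Llog q a b (hadamard_deriv a \<alpha> u) \<Longrightarrow> a < t \<Longrightarrow> t < b \<Longrightarrow>
      \<bar>u t\<bar> \<le> K * Llog_norm q a b (hadamard_deriv a \<alpha> u)"
    using hadamard_deriv_sup_bound[of a b q \<alpha>] assms by blast
  \<comment> \<open>Interpolation with \<open>M\<close> equal to \<open>K\<close> times the norm of
    the derivative produces exactly this constant.\<close>
  define C where "C = (b - a) powr (s / q) * K powr s"
  have "in_L \<gamma> a b u \<and> L_norm \<gamma> a b u
      \<le> C * Llog_norm q a b (hadamard_deriv a \<alpha> u) powr s * L_norm p a b u powr (1 - s)"
    if "hadamard_deriv_exists a b \<alpha> u" "(u \<longlongrightarrow> 0) (at_right a)"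
      "in_Llog q a b (hadamard_deriv a \<alpha> u)" "in_L p a b u" for u
  proof -
    have "0 \<le> Llog_norm q a b (hadamard_deriv a \<alpha> u)" by (simp add: Lw_norm_def)
    then have "C * Llog_norm q a b (hadamard_deriv a \<alpha> u) powr s
        = (b - a) powr (s / q) * (K * Llog_norm q a b (hadamard_deriv a \<alpha> u)) powr s"
      using K by (simp add: C_def powr_mult)
    moreover have "in_L \<gamma> a b u \<and> L_norm \<gamma> a b u
        \<le> (b - a) powr (s / q) * (K * Llog_norm q a b (hadamard_deriv a \<alpha> u)) powr s * L_norm p a b u powr (1 - s)"
      using assms that(4) by (intro L_norm_interpolation_sup bound[OF that(1-3)]) auto
    ultimately show ?thesis by simp
  qed
  moreover have "0 < C" using assms K by (simp add: C_def)
  ultimately show ?thesis by blast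
qed

end
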